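(* Let $d\geqslant 2$ be an integer, let $w(t)=(w_1(t),\dots,w_d(t))$, $0\leqslant t\leqslant1$, be a $d$-dimensional Brownian motion, and let $Z_i=\max_{0\leqslant s\leqslant1}|w_i(s)|$ for $i=1,\dots,d$. Let $n_1,\dots,n_d\geqslant 0$ be integers. Then there exist deterministic constants $C_0$ and $C(n_1,\dots,n_d)$ (not depending on $u$ nor on the sample path) such that, almost surely, as $u\to0$ (that is, for all $u=(u_1,\dots,u_d)\in\mathbb{R}^d\setminus\{0\}$ sufficiently close to $0$), $$\left|\int_{\Delta_2}\prod_{j=1}^d H_{n_j}\left(\frac{w_j(t)-w_j(s)}{\sqrt{t-s}}\right)H_{n_j}\left(\frac{u_j}{\sqrt{t-s}}\right)p^d_{t-s}(u)\,ds\,dt\right|\leqslant\begin{cases}C_0\log\Big(\dfrac1{\|u\|}\Big)&\text{if }d=2,\ n_1=n_2=0,\\[3mm] C(n_1,\dots,n_d)\,\dfrac{\exp(2Z_1+\cdots+2Z_d)}{\|u\|^{n_1+\cdots+n_d+d-2}}&\text{otherwise.}\end{cases}$$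
   Context: $\Delta_2=\{(s,t)\in[0,1]^2 : s<t\}$. For $\varepsilon>0$ and $z\in\mathbb{R}^d$, $p^d_\varepsilon(z)=\frac{1}{(2\pi\varepsilon)^{d/2}}\exp\left(-\frac{\|z\|^2}{2\varepsilon}\right)$. $H_n$ denotes the Hermite polynomial $H_n(x)=(-1)^n e^{x^2/2}\,\frac{d^n}{dx^n}e^{-x^2/2}$. Brownian motion starts at $0$. *)

theory Defs
  imports "HOL-Probability.Probability"
begin

definition simplex2 :: "(real \<times> real) set" where
  "simplex2 = {(s, t). s \<in> {0..1} \<and> t \<in> {0..1} \<and> s < t}"

definition gauss_kernel :: "real \<Rightarrow> real ^ 'd \<Rightarrow> real" where
  "gauss_kernel \<epsilon> z =
     1 / (2 * pi * \<epsilon>) powr (real CARD('d) / 2) * exp (- (norm z)\<^sup>2 / (2 * \<epsilon>))"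

definition hermite :: "nat \<Rightarrow> real \<Rightarrow> real" where
  "hermite n x = (- 1) ^ n * exp (x\<^sup>2 / 2) * (deriv ^^ n) (\<lambda>y. exp (- y\<^sup>2 / 2)) x"

text \<open>
  Standard Brownian motion in \<open>d\<close> dimensions, started at the origin, with time set \<open>[0, 1]\<close>
  (values of \<open>w\<close> at other times are irrelevant). The function \<open>gauss_kernel (t - s)\<close> is the
  Lebesgue density of the centred normal law with covariance matrix \<open>(t - s)\<close> times the identity,
  so the coordinates of an increment are independent. The starting point and the continuity of
  paths are only required almost surely.
\<close>

locale brownian_motion = prob_space M
  for M :: "'a measure" and w :: "real \<Rightarrow> 'a \<Rightarrow> real ^ 'd" +
  assumes measurable_at: "\<And>t. t \<in> {0..1} \<Longrightarrow> w t \<in> borel_measurable M"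
    and starts_at_0: "AE \<omega> in M. w 0 \<omega> = 0"
    and gaussian_increments:
      "\<And>s t. 0 \<le> s \<Longrightarrow> s < t \<Longrightarrow> t \<le> 1 \<Longrightarrow>
         distributed M lborel (\<lambda>\<omega>. w t \<omega> - w s \<omega>) (\<lambda>z. ennreal (gauss_kernel (t - s) z))"
    and independent_increments:
      "\<And>(k :: nat) \<tau>. 0 \<le> \<tau> 0 \<Longrightarrow> (\<And>i. i < k \<Longrightarrow> \<tau> i < \<tau> (Suc i)) \<Longrightarrow> \<tau> k \<le> 1 \<Longrightarrow>
         indep_vars (\<lambda>_. borel) (\<lambda>i \<omega>. w (\<tau> (Suc i)) \<omega> - w (\<tau> i) \<omega>) {..<k}"
    and continuous_paths: "AE \<omega> in M. continuous_on {0..1} (\<lambda>t. w t \<omega>)"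

text \<open>
  The supremum below is a maximum whenever the path is continuous.
\<close>

definition max_abs :: "(real \<Rightarrow> real ^ 'd) \<Rightarrow> 'd \<Rightarrow> real" where
  "max_abs x i = (SUP s\<in>{0..1}. \<bar>x s $ i\<bar>)"

definition hermite_integrand ::
    "('d \<Rightarrow> nat) \<Rightarrow> (real \<Rightarrow> real ^ 'd) \<Rightarrow> real ^ 'd \<Rightarrow> real \<times> real \<Rightarrow> real" where
  "hermite_integrand n x u = (\<lambda>(s, t).
     (\<Prod>j\<in>UNIV. hermite (n j) ((x t $ j - x s $ j) / sqrt (t - s))
                * hermite (n j) (u $ j / sqrt (t - s)))
     * gauss_kernel (t - s) u)"

end

theory Submission
  imports Defs
begin

text \<open>
  The bound is a deterministic statement about a single path \<open>x\<close> that is continuous on \<open>[0, 1]\<close>;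
  almost every path of a Brownian motion is of this kind.

  Write \<open>\<tau> = t - s\<close>, \<open>r = norm u\<close>, \<open>N = \<Sum>j. n j\<close>, \<open>d = CARD('d)\<close>,
  \<open>k = N + d\<close> and \<open>Z\<^sub>j = max_abs x j\<close>. Since
  \<open>hermite n\<close> is a polynomial of degree at most \<open>n\<close> (\<open>hermite_polynomial\<close>) and \<open>\<tau> \<le> 1\<close>,
  each Hermite factor in the path increment costs at most a constant times
  \<open>\<tau> powr (- n j / 2) * (1 + \<bar>x t $ j - x s $ j\<bar>) ^ n j\<close>, while the factors in \<open>u\<close> cost a power
  of \<open>1 + r / sqrt \<tau>\<close>, which the Gaussian kernel absorbs. What is left is singular like
  \<open>\<tau> powr (- k / 2) * exp (- r\<^sup>2 / (2 * \<tau>))\<close>, up to polynomial factors in \<open>r / sqrt \<tau>\<close>.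
  As a function of \<open>\<tau>\<close> this is a power of \<open>\<tau>\<close> cut off at scale \<open>r\<^sup>2\<close>, so it is dominated by
  \<open>(\<tau> + r\<^sup>2) powr (- k / 2)\<close> (\<open>heat_kernel_profile_le\<close>, \<open>hermite_integrand_pointwise_bound\<close>).

  The dominating function depends on \<open>t - s\<close> alone and has an elementary antiderivative. Its
  integral over \<open>[0, 1]\<close> is of order \<open>r powr (2 - k)\<close> when \<open>k \<ge> 3\<close>, and of order
  \<open>ln (1 / r)\<close> when \<open>k = 2\<close>, which happens exactly for \<open>d = 2\<close> and \<open>n = 0\<close>. In the first case the
  powers of the increments are absorbed into \<open>exp (\<Sum>j. 2 * Z\<^sub>j)\<close> by means of \<open>y ^ n \<le> fact n * exp y\<close>
  and \<open>\<bar>x t $ j - x s $ j\<bar> \<le> 2 * Z\<^sub>j\<close>. In the second case these powers are all \<open>1\<close>, and for this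
  reason the logarithmic bound does not depend on the path at all.
\<close>

section \<open>Growth of Hermite polynomials\<close>

text \<open>
  Differentiating \<open>p x * exp (- x\<^sup>2 / 2)\<close> replaces \<open>p\<close> by \<open>p' - x p\<close>, which raises the degree by
  at most one.
\<close>

lemma deriv_gauss_polynomial:
  "\<exists>p :: real poly. degree p \<le> n \<and>
     (deriv ^^ n) (\<lambda>y. exp (- y\<^sup>2 / 2)) = (\<lambda>x. poly p x * exp (- x\<^sup>2 / 2))"
proof (induction n)
  case 0
  show ?case by (rule exI[of _ 1]) auto
next
  case (Suc n)
  then obtain p :: "real poly" where p: "degree p \<le> n"
    "(deriv ^^ n) (\<lambda>y. exp (- y\<^sup>2 / 2)) = (\<lambda>x. poly p x * exp (- x\<^sup>2 / 2))" by blast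
  let ?q = "pderiv p - pCons 0 p"
  have "((\<lambda>x. poly p x * exp (- x\<^sup>2 / 2)) has_real_derivative poly ?q x * exp (- x\<^sup>2 / 2)) (at x)" for x
    by (auto intro!: derivative_eq_intros simp: algebra_simps)
  then have "deriv (\<lambda>x. poly p x * exp (- x\<^sup>2 / 2)) = (\<lambda>x. poly ?q x * exp (- x\<^sup>2 / 2))"
    using DERIV_imp_deriv by blast
  moreover have "degree ?q \<le> Suc n"
    using p(1) degree_pCons_le[of 0 p] by (intro degree_diff_le) (auto simp: degree_pderiv)
  ultimately show ?case using p(2) by auto
qed

lemma hermite_polynomial: "\<exists>p. degree p \<le> n \<and> hermite n = poly p"
proof -
  obtain p :: "real poly" where p: "degree p \<le> n"
    "(deriv ^^ n) (\<lambda>y. exp (- y\<^sup>2 / 2)) = (\<lambda>x. poly p x * exp (- x\<^sup>2 / 2))"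
    using deriv_gauss_polynomial by blast
  have "hermite n x = poly (smult ((- 1) ^ n) p) x" for x
    unfolding hermite_def p(2) by (simp add: mult_ac flip: exp_add)
  then show ?thesis using p(1) degree_smult_le[of "(- 1) ^ n" p] by (metis ext le_trans)
qed

lemma continuous_on_hermite [continuous_intros]:
  "continuous_on A f \<Longrightarrow> continuous_on A (\<lambda>x. hermite n (f x))"
  using hermite_polynomial[of n] by (auto intro!: continuous_intros)

lemma hermite_growth: "\<exists>c\<ge>0. \<forall>x. \<bar>hermite n x\<bar> \<le> c * (1 + \<bar>x\<bar>) ^ n"
proof -
  obtain p where p: "degree p \<le> n" "hermite n = poly p" using hermite_polynomial by blast
  define c where "c = (\<Sum>i\<le>degree p. \<bar>coeff p i\<bar>)"
  have "\<bar>hermite n x\<bar> \<le> c * (1 + \<bar>x\<bar>) ^ n" for x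
  proof -
    have "\<bar>hermite n x\<bar> \<le> (\<Sum>i\<le>degree p. \<bar>coeff p i * x ^ i\<bar>)"
      unfolding p(2) poly_altdef by (rule sum_abs)
    also have "\<dots> \<le> (\<Sum>i\<le>degree p. \<bar>coeff p i\<bar> * (1 + \<bar>x\<bar>) ^ n)"
    proof (rule sum_mono)
      fix i assume "i \<in> {..degree p}"
      then have "(1 + \<bar>x\<bar>) ^ i \<le> (1 + \<bar>x\<bar>) ^ n" using p(1) by (intro power_increasing) auto
      moreover have "\<bar>x\<bar> ^ i \<le> (1 + \<bar>x\<bar>) ^ i" by (intro power_mono) auto
      ultimately show "\<bar>coeff p i * x ^ i\<bar> \<le> \<bar>coeff p i\<bar> * (1 + \<bar>x\<bar>) ^ n"
        by (auto simp: abs_mult power_abs intro!: mult_left_mono)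
    qed
    finally show ?thesis by (simp add: c_def sum_distrib_right)
  qed
  moreover have "c \<ge> 0" by (simp add: c_def sum_nonneg)
  ultimately show ?thesis by blast
qed

lemma hermite_0 [simp]: "hermite 0 x = 1"
  by (simp add: hermite_def flip: exp_add)

section \<open>Pointwise domination of the integrand\<close>

text \<open>
  The left-hand side, divided by \<open>fact k\<close>, is a single term of the exponential series.
\<close>

lemma power_le_fact_exp:
  fixes y :: real
  assumes "0 \<le> y"
  shows "y ^ k \<le> fact k * exp y"
proof -
  have "y ^ k /\<^sub>R fact k \<le> exp y"
    unfolding exp_def
    using sum_le_suminf[OF summable_exp_generic[of y], of "{k}"] assms by auto
  then show ?thesis by (simp add: field_simps)
qed

lemma power_mult_gauss_le:
  fixes q :: real
  assumes "0 \<le> q"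
  shows "(1 + q) ^ k * exp (- q\<^sup>2 / 2) \<le> fact k * exp (3 / 2)"
proof -
  have "(1 + q) ^ k * exp (- q\<^sup>2 / 2) \<le> fact k * exp (1 + q) * exp (- q\<^sup>2 / 2)"
    using power_le_fact_exp[of "1 + q" k] assms by (intro mult_right_mono) auto
  also have "\<dots> = fact k * exp (1 + q - q\<^sup>2 / 2)"
    unfolding mult.assoc exp_add[symmetric] by simp
  also have "\<dots> \<le> fact k * exp (3 / 2)"
  proof (intro mult_left_mono)
    \<comment> \<open>\<open>q - q\<^sup>2 / 2\<close> is largest at \<open>q = 1\<close>, where it equals \<open>1 / 2\<close>.\<close>
    have "0 \<le> (q - 1)\<^sup>2" by simp
    then have "1 + q - q\<^sup>2 / 2 \<le> 3 / 2" unfolding power2_diff by simp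
    then show "exp (1 + q - q\<^sup>2 / 2) \<le> exp (3 / 2)" by simp
  qed simp
  finally show ?thesis .
qed

text \<open>
  This replaces the singular factor \<open>\<tau> powr (- k / 2)\<close>, which blows up at the diagonal, by
  \<open>(\<tau> + r\<^sup>2) powr (- k / 2)\<close>, which is easy to integrate. With \<open>\<sigma> = sqrt \<tau>\<close> and \<open>q = r / \<sigma>\<close> one has
  \<open>1 / \<sigma> ^ k = (1 + q) ^ k / (\<sigma> + r) ^ k\<close>. The extra power of \<open>1 + q\<close> is harmless, because the
  Gaussian factor \<open>exp (- q\<^sup>2 / 2)\<close> beats every polynomial in \<open>q\<close>, and \<open>(\<sigma> + r)\<^sup>2 \<ge> \<tau> + r\<^sup>2\<close>.
\<close>

lemma heat_kernel_profile_le: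
  fixes r \<tau> :: real
  assumes "0 < \<tau>" "0 \<le> r"
  shows "(1 + r / sqrt \<tau>) ^ N * exp (- r\<^sup>2 / (2 * \<tau>)) / sqrt \<tau> ^ k
           \<le> fact (N + k) * exp (3 / 2) * (\<tau> + r\<^sup>2) powr (- real k / 2)"
proof -
  define \<sigma> q where "\<sigma> = sqrt \<tau>" and "q = r / \<sigma>"
  have \<sigma>: "0 < \<sigma>" "\<sigma>\<^sup>2 = \<tau>" "0 \<le> q" using assms by (auto simp: \<sigma>_def q_def)
  have eq: "\<sigma> * (1 + q) = \<sigma> + r" using \<sigma> by (simp add: q_def field_simps)
  have "(\<tau> + r\<^sup>2) powr (real k / 2) \<le> ((\<sigma> + r)\<^sup>2) powr (real k / 2)"
    using assms \<sigma> by (intro powr_mono2) (auto simp: power2_sum)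
  also have "\<dots> = (\<sigma> + r) ^ k"
    using assms \<sigma> by (simp add: powr_powr powr_realpow flip: powr_numeral)
  finally have le: "(\<tau> + r\<^sup>2) powr (real k / 2) \<le> (\<sigma> + r) ^ k" .
  have pos: "0 < \<tau> + r\<^sup>2" using assms by (simp add: add_pos_nonneg)
  have "(1 + q) ^ N * exp (- q\<^sup>2 / 2) / \<sigma> ^ k
          = (1 + q) ^ (N + k) * exp (- q\<^sup>2 / 2) * (1 / (\<sigma> + r) ^ k)"
    using \<sigma> unfolding eq[symmetric] power_mult_distrib power_add by (simp add: field_simps)
  also have "\<dots> \<le> fact (N + k) * exp (3 / 2) * (\<tau> + r\<^sup>2) powr (- real k / 2)"
  proof (rule mult_mono)
    show "(1 + q) ^ (N + k) * exp (- q\<^sup>2 / 2) \<le> fact (N + k) * exp (3 / 2)"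
      using \<sigma> by (intro power_mult_gauss_le) auto
    show "1 / (\<sigma> + r) ^ k \<le> (\<tau> + r\<^sup>2) powr (- real k / 2)"
      using le pos by (simp add: powr_minus_divide frac_le)
  qed (use \<sigma> assms in auto)
  finally show ?thesis using \<sigma> by (simp add: q_def \<sigma>_def power_divide mult.commute)
qed

lemma gauss_kernel_le:
  fixes u :: "real ^ 'd"
  assumes "0 < \<tau>"
  shows "gauss_kernel \<tau> u \<le> exp (- (norm u)\<^sup>2 / (2 * \<tau>)) / sqrt \<tau> ^ CARD('d)"
proof -
  have "sqrt \<tau> ^ CARD('d) = (\<tau> powr (1 / 2)) powr real CARD('d)"
    using assms by (subst powr_realpow) (auto simp: powr_half_sqrt)
  also have "\<dots> = \<tau> powr (real CARD('d) / 2)" by (simp add: powr_powr)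
  also have "\<dots> \<le> (2 * pi * \<tau>) powr (real CARD('d) / 2)"
    using assms pi_gt3 by (intro powr_mono2) auto
  finally show ?thesis
    using assms unfolding gauss_kernel_def by (auto intro!: divide_left_mono simp: mult_pos_pos)
qed

text \<open>
  The increments of the path are kept as the explicit product \<open>\<Prod>j. (1 + \<bar>x t $ j - x s $ j\<bar>) ^ n j\<close>
  instead of being bounded by an exponential here: the product is \<open>1\<close> when \<open>n = 0\<close>, so the same
  estimate serves the logarithmic case, whose bound contains no path-dependent factor.
\<close>

lemma hermite_integrand_pointwise_bound:
  shows "\<exists>K. (\<forall>n. 0 \<le> K n) \<and> (\<forall>n x (u :: real ^ 'd::finite) s t. 0 < t - s \<longrightarrow> t - s \<le> 1 \<longrightarrow>
     \<bar>hermite_integrand n x u (s, t)\<bar>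
       \<le> K n * (\<Prod>j\<in>UNIV. (1 + \<bar>x t $ j - x s $ j\<bar>) ^ n j)
           * (t - s + (norm u)\<^sup>2) powr (- real ((\<Sum>j\<in>UNIV. n j) + CARD('d)) / 2))"
proof -
  obtain c where c: "\<And>k. c k \<ge> 0" "\<And>k x. \<bar>hermite k x\<bar> \<le> c k * (1 + \<bar>x\<bar>) ^ k"
    using hermite_growth by metis
  define N where "N n = (\<Sum>j\<in>UNIV. n j)" for n :: "'d \<Rightarrow> nat"
  define L where "L n = (\<Prod>j\<in>UNIV. c (n j) * c (n j))" for n :: "'d \<Rightarrow> nat"
  define K where "K n = L n * (fact (N n + (N n + CARD('d))) * exp (3 / 2))" for n
  have L: "0 \<le> L n" for n by (auto simp: L_def c intro!: prod_nonneg)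
  have "\<bar>hermite_integrand n x u (s, t)\<bar>
       \<le> K n * (\<Prod>j\<in>UNIV. (1 + \<bar>x t $ j - x s $ j\<bar>) ^ n j)
           * (t - s + (norm u)\<^sup>2) powr (- real (N n + CARD('d)) / 2)"
    if \<tau>: "0 < t - s" "t - s \<le> 1" for n x and u :: "real ^ 'd" and s t
  proof -
    define \<sigma> where "\<sigma> = sqrt (t - s)"
    define a where "a = (\<lambda>j. \<bar>x t $ j - x s $ j\<bar>)"
    define P where "P = (\<Prod>j\<in>UNIV. (1 + a j) ^ n j)"
    have \<sigma>: "0 < \<sigma>" "\<sigma> \<le> 1" using \<tau> by (auto simp: \<sigma>_def)
    have P: "0 \<le> P" by (auto simp: P_def a_def intro!: prod_nonneg)
    have factor: "\<bar>hermite (n j) ((x t $ j - x s $ j) / \<sigma>) * hermite (n j) (u $ j / \<sigma>)\<bar>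
        \<le> c (n j) * c (n j) * (1 + a j) ^ n j * ((1 + norm u / \<sigma>) / \<sigma>) ^ n j" for j
    proof -
      \<comment> \<open>Here \<open>\<sigma> \<le> 1\<close> is used to pull the whole factor \<open>1 / \<sigma>\<close> out.\<close>
      have "1 + \<bar>(x t $ j - x s $ j) / \<sigma>\<bar> \<le> (1 + a j) / \<sigma>"
        using \<sigma> by (simp add: a_def field_simps)
      then have "c (n j) * (1 + \<bar>(x t $ j - x s $ j) / \<sigma>\<bar>) ^ n j \<le> c (n j) * ((1 + a j) / \<sigma>) ^ n j"
        using c by (intro mult_left_mono power_mono) auto
      with c(2) have 1: "\<bar>hermite (n j) ((x t $ j - x s $ j) / \<sigma>)\<bar> \<le> c (n j) * ((1 + a j) / \<sigma>) ^ n j"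
        by (rule order_trans)
      have "1 + \<bar>u $ j / \<sigma>\<bar> \<le> 1 + norm u / \<sigma>"
        using \<sigma> component_le_norm_cart[of u j] by (simp add: divide_right_mono)
      then have "c (n j) * (1 + \<bar>u $ j / \<sigma>\<bar>) ^ n j \<le> c (n j) * (1 + norm u / \<sigma>) ^ n j"
        using c by (intro mult_left_mono power_mono) auto
      with c(2) have 2: "\<bar>hermite (n j) (u $ j / \<sigma>)\<bar> \<le> c (n j) * (1 + norm u / \<sigma>) ^ n j"
        by (rule order_trans)
      have "\<bar>hermite (n j) ((x t $ j - x s $ j) / \<sigma>) * hermite (n j) (u $ j / \<sigma>)\<bar>
          \<le> (c (n j) * ((1 + a j) / \<sigma>) ^ n j) * (c (n j) * (1 + norm u / \<sigma>) ^ n j)"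
        unfolding abs_mult using 1 2 by (intro mult_mono) (auto intro: order_trans[OF abs_ge_zero])
      then show ?thesis by (simp add: power_divide power_mult_distrib mult_ac)
    qed
    have "\<bar>hermite_integrand n x u (s, t)\<bar>
        = (\<Prod>j\<in>UNIV. \<bar>hermite (n j) ((x t $ j - x s $ j) / \<sigma>) * hermite (n j) (u $ j / \<sigma>)\<bar>)
            * gauss_kernel (t - s) u"
      unfolding hermite_integrand_def \<sigma>_def prod.case abs_mult[of "prod _ _"] abs_prod
      by (simp add: gauss_kernel_def)
    also have "\<dots> \<le> (\<Prod>j\<in>UNIV. c (n j) * c (n j) * (1 + a j) ^ n j * ((1 + norm u / \<sigma>) / \<sigma>) ^ n j)
        * (exp (- (norm u)\<^sup>2 / (2 * (t - s))) / \<sigma> ^ CARD('d))"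
      unfolding \<sigma>_def
      using factor[unfolded \<sigma>_def] gauss_kernel_le[OF \<tau>(1)] c \<tau>
      by (intro mult_mono prod_mono)
        (auto simp: gauss_kernel_def a_def intro!: prod_nonneg mult_nonneg_nonneg)
    also have "\<dots> = L n * P * ((1 + norm u / \<sigma>) ^ N n * exp (- (norm u)\<^sup>2 / (2 * (t - s))) / \<sigma> ^ (N n + CARD('d)))"
      by (simp add: prod.distrib L_def P_def N_def power_divide power_add power_sum prod_dividef)
    also have "\<dots> \<le> L n * P * (fact (N n + (N n + CARD('d))) * exp (3 / 2)
        * (t - s + (norm u)\<^sup>2) powr (- real (N n + CARD('d)) / 2))"
      unfolding \<sigma>_def using L P \<tau> by (intro mult_left_mono heat_kernel_profile_le) auto
    finally show ?thesis by (simp add: K_def P_def a_def mult_ac)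
  qed
  moreover have "0 \<le> K n" for n using L by (simp add: K_def)
  ultimately show ?thesis unfolding N_def by blast
qed

section \<open>Integration over the simplex\<close>

lemma simplex2_borel [measurable]: "simplex2 \<in> sets borel"
proof -
  have "simplex2 = ({0..1} \<times> {0..1}) \<inter> {z. fst z < snd z}"
    by (auto simp: simplex2_def)
  moreover have "closed ({0..1::real} \<times> {0..1::real})" by (intro closed_Times) auto
  moreover have "open {z :: real \<times> real. fst z < snd z}"
    by (intro open_Collect_less continuous_intros)
  ultimately show ?thesis by (metis borel_closed borel_open sets.Int)
qed

text \<open>
  Tonelli's theorem together with the fundamental theorem of calculus: for fixed \<open>s\<close> the integral
  of \<open>g (t - s)\<close> over \<open>t \<in> {s..1}\<close> is \<open>F (1 - s) - F 0\<close>, and the remaining integral over \<open>s\<close>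
  runs over an interval of length one.
\<close>

lemma simplex2_integral_bound:
  fixes f :: "real \<times> real \<Rightarrow> real" and F g :: "real \<Rightarrow> real"
  assumes cont: "continuous_on simplex2 f"
    and bound: "\<And>s t. (s, t) \<in> simplex2 \<Longrightarrow> \<bar>f (s, t)\<bar> \<le> B * g (t - s)"
    and deriv: "\<And>\<tau>. 0 \<le> \<tau> \<Longrightarrow> (F has_real_derivative g \<tau>) (at \<tau>)"
    and cont_g: "continuous_on {0..} g"
    and g0: "\<And>\<tau>. 0 \<le> \<tau> \<Longrightarrow> 0 \<le> g \<tau>"
    and B: "0 \<le> B"
    and F: "\<And>\<tau>. 0 \<le> \<tau> \<Longrightarrow> \<tau> \<le> 1 \<Longrightarrow> F \<tau> - F 0 \<le> D"
  shows "set_integrable lborel simplex2 f \<and> \<bar>set_lebesgue_integral lborel simplex2 f\<bar> \<le> B * D"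
proof -
  have D: "0 \<le> D" using F[of 0] by simp
  have meas: "(\<lambda>z. indicator simplex2 z *\<^sub>R f z) \<in> borel_measurable borel"
    by (rule borel_measurable_continuous_on_indicator[OF _ cont]) simp
  have meas2: "(\<lambda>z. ennreal (norm (indicator simplex2 z *\<^sub>R f z))) \<in> borel_measurable (lborel \<Otimes>\<^sub>M lborel)"
    using meas by (simp add: lborel_prod)
  have inner: "(\<integral>\<^sup>+t. ennreal (norm (indicator simplex2 (s, t) *\<^sub>R f (s, t))) \<partial>lborel)
                 \<le> ennreal (B * D) * indicator {0..1} s" for s
  proof (cases "s \<in> {0..1}")
    case s: True
    have mg: "(\<lambda>t. indicator {s..1} t *\<^sub>R g (t - s)) \<in> borel_measurable borel"
      by (rule borel_measurable_continuous_on_indicator)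
         (auto intro!: continuous_intros continuous_on_compose2[OF cont_g])
    have "(\<integral>\<^sup>+t. ennreal (norm (indicator simplex2 (s, t) *\<^sub>R f (s, t))) \<partial>lborel)
        \<le> (\<integral>\<^sup>+t. ennreal B * ennreal (indicator {s..1} t *\<^sub>R g (t - s)) \<partial>lborel)"
      using bound B g0
      by (intro nn_integral_mono) (auto simp: simplex2_def indicator_def ennreal_mult[symmetric])
    also have "\<dots> = ennreal B * (\<integral>\<^sup>+t. ennreal (indicator {s..1} t *\<^sub>R g (t - s)) \<partial>lborel)"
      using mg by (intro nn_integral_cmult) auto
    also have "(\<integral>\<^sup>+t. ennreal (indicator {s..1} t *\<^sub>R g (t - s)) \<partial>lborel)
        = ennreal (F (1 - s) - F (s - s))"
    proof (rule nn_integral_has_integral_lborel)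
      show "0 \<le> indicator {s..1} t *\<^sub>R g (t - s)" for t using g0 by (auto simp: indicator_def)
      show "(\<lambda>t. indicator {s..1} t *\<^sub>R g (t - s)) \<in> borel_measurable borel" by (rule mg)
      have "((\<lambda>t. g (t - s)) has_integral (F (1 - s) - F (s - s))) {s..1}"
      proof (rule fundamental_theorem_of_calculus)
        fix t assume "t \<in> {s..1}"
        then have "(F has_real_derivative g (t - s)) (at (t - s))" by (intro deriv) auto
        then have "((\<lambda>t. F (t - s)) has_real_derivative g (t - s)) (at t)"
          using DERIV_shift[of F "g (t - s)" t "- s"] by (simp add: DERIV_shift)
        then show "((\<lambda>t. F (t - s)) has_vector_derivative g (t - s)) (at t within {s..1})"
          by (simp add: has_real_derivative_iff_has_vector_derivative has_vector_derivative_at_within)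
      qed (use s in auto)
      then show "((\<lambda>t. indicator {s..1} t *\<^sub>R g (t - s)) has_integral (F (1 - s) - F (s - s))) UNIV"
        using has_integral_restrict_UNIV[of "{s..1}" "\<lambda>t. g (t - s)"]
        by (simp add: indicator_def of_bool_def if_distrib if_distribR cong: if_cong)
    qed
    also have "ennreal B * \<dots> \<le> ennreal B * ennreal D"
      using F[of "1 - s"] s by (intro mult_left_mono ennreal_leI) auto
    finally show ?thesis using s B D by (simp add: ennreal_mult)
  qed (auto simp: simplex2_def indicator_def)
  have "(\<integral>\<^sup>+z. ennreal (norm (indicator simplex2 z *\<^sub>R f z)) \<partial>lborel)
      = (\<integral>\<^sup>+s. \<integral>\<^sup>+t. ennreal (norm (indicator simplex2 (s, t) *\<^sub>R f (s, t))) \<partial>lborel \<partial>lborel)"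
    using lborel.nn_integral_fst[OF meas2] by (simp add: lborel_prod)
  also have "\<dots> \<le> (\<integral>\<^sup>+s. ennreal (B * D) * indicator {0..1} (s::real) \<partial>lborel)"
    by (intro nn_integral_mono inner)
  also have "\<dots> = ennreal (B * D)"
    by (simp add: nn_integral_cmult_indicator)
  finally have le: "(\<integral>\<^sup>+z. ennreal (norm (indicator simplex2 z *\<^sub>R f z)) \<partial>lborel) \<le> ennreal (B * D)" .
  then have int: "integrable lborel (\<lambda>z. indicator simplex2 z *\<^sub>R f z)"
    using meas by (auto simp: integrable_iff_bounded intro: le_less_trans)
  have "ennreal (norm (integral\<^sup>L lborel (\<lambda>z. indicator simplex2 z *\<^sub>R f z))) \<le> ennreal (B * D)"
    using integral_norm_bound_ennreal[OF int] le by (rule order_trans)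
  then show ?thesis
    using int B D unfolding set_integrable_def set_lebesgue_integral_def
    by (simp add: ennreal_le_iff)
qed

lemma simplex2_integral_power_bound:
  fixes f :: "real \<times> real \<Rightarrow> real"
  assumes cont: "continuous_on simplex2 f"
    and bound: "\<And>s t. (s, t) \<in> simplex2 \<Longrightarrow> \<bar>f (s, t)\<bar> \<le> B * (t - s + r\<^sup>2) powr (- real k / 2)"
    and B: "0 \<le> B" and r: "0 < r" and k: "3 \<le> k"
  shows "set_integrable lborel simplex2 f \<and>
         \<bar>set_lebesgue_integral lborel simplex2 f\<bar> \<le> B * (2 / r ^ (k - 2))"
proof (rule simplex2_integral_bound[OF cont bound _ _ _ B])
  \<comment> \<open>The exponent of the antiderivative. It is at most \<open>- 1 / 2\<close>, which gives the factor \<open>2\<close> in the bound.\<close>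
  define e where "e = 1 - real k / 2"
  have e: "e \<le> - 1 / 2" using k by (simp add: e_def)
  let ?F = "\<lambda>\<tau>. (\<tau> + r\<^sup>2) powr e / e"
  have pos: "0 < \<tau> + r\<^sup>2" if "0 \<le> \<tau>" for \<tau> using r that by (simp add: add_nonneg_pos)
  show "(?F has_real_derivative (\<tau> + r\<^sup>2) powr (- real k / 2)) (at \<tau>)" if "0 \<le> \<tau>" for \<tau>
    using pos[OF that] e by (auto intro!: derivative_eq_intros) (simp add: e_def)
  show "continuous_on {0..} (\<lambda>\<tau>. (\<tau> + r\<^sup>2) powr (- real k / 2))"
    using pos by (fastforce intro!: continuous_intros)
  show "?F \<tau> - ?F 0 \<le> 2 / r ^ (k - 2)" if "0 \<le> \<tau>" for \<tau>
  proof -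
    have "(r\<^sup>2) powr e = r powr (- real (k - 2))"
      using r k by (simp add: powr_powr e_def of_nat_diff flip: powr_numeral)
    also have "\<dots> = 1 / r ^ (k - 2)"
      using r by (simp add: powr_minus powr_realpow divide_inverse)
    finally have re: "(r\<^sup>2) powr e = 1 / r ^ (k - 2)" .
    have "?F \<tau> \<le> 0" using e by (auto intro!: divide_nonneg_neg)
    then have "?F \<tau> - ?F 0 \<le> (1 / r ^ (k - 2)) * (1 / - e)" using re by simp
    also have "\<dots> \<le> (1 / r ^ (k - 2)) * 2"
      using r e by (intro mult_left_mono) (auto simp: field_simps)
    finally show ?thesis by simp
  qed
qed auto

text \<open>
  The borderline exponent, with antiderivative \<open>ln (\<tau> + r\<^sup>2)\<close>. Between the end points it grows by at
  most \<open>ln 2 + 2 * ln (1 / r)\<close>, and the restriction \<open>r \<le> 1 / 2\<close> lets \<open>ln (1 / r)\<close> absorb \<open>ln 2\<close>.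
\<close>

lemma simplex2_integral_log_bound:
  fixes f :: "real \<times> real \<Rightarrow> real"
  assumes cont: "continuous_on simplex2 f"
    and bound: "\<And>s t. (s, t) \<in> simplex2 \<Longrightarrow> \<bar>f (s, t)\<bar> \<le> B * (t - s + r\<^sup>2) powr (- 1)"
    and B: "0 \<le> B" and r: "0 < r" "r \<le> 1 / 2"
  shows "set_integrable lborel simplex2 f \<and>
         \<bar>set_lebesgue_integral lborel simplex2 f\<bar> \<le> B * (3 * ln (1 / r))"
proof (rule simplex2_integral_bound[OF cont bound _ _ _ B])
  let ?F = "\<lambda>\<tau>. ln (\<tau> + r\<^sup>2)"
  have pos: "0 < \<tau> + r\<^sup>2" if "0 \<le> \<tau>" for \<tau> using r that by (simp add: add_nonneg_pos)
  show "(?F has_real_derivative (\<tau> + r\<^sup>2) powr (- 1)) (at \<tau>)" if "0 \<le> \<tau>" for \<tau>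
    using pos[OF that] by (auto intro!: derivative_eq_intros simp: powr_minus_divide)
  show "continuous_on {0..} (\<lambda>\<tau>. (\<tau> + r\<^sup>2) powr (- 1))"
    using pos by (fastforce intro!: continuous_intros)
  show "?F \<tau> - ?F 0 \<le> 3 * ln (1 / r)" if "0 \<le> \<tau>" "\<tau> \<le> 1" for \<tau>
  proof -
    have "r\<^sup>2 \<le> 1" using r by (simp add: power_le_one)
    have "?F \<tau> \<le> ln 2" using pos[OF that(1)] that \<open>r\<^sup>2 \<le> 1\<close> by simp
    also have "ln 2 \<le> ln (1 / r)" using r by (simp add: field_simps)
    finally show ?thesis using r by (simp add: ln_realpow ln_div)
  qed
qed auto

section \<open>Continuous paths and the conclusion\<close>

text \<open>
  The integrand is singular only on the diagonal, which \<open>simplex2\<close> excludes. Continuity off the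
  diagonal supplies the measurability needed for integrability.
\<close>

lemma continuous_on_hermite_integrand:
  fixes x :: "real \<Rightarrow> real ^ 'd::finite"
  assumes x: "continuous_on {0..1} x"
  shows "continuous_on simplex2 (hermite_integrand n x u)"
proof -
  have xs: "continuous_on simplex2 (\<lambda>z. x (fst z) $ j)" "continuous_on simplex2 (\<lambda>z. x (snd z) $ j)" for j
    by (auto intro!: continuous_intros continuous_on_compose2[OF x] simp: simplex2_def)
  show ?thesis
    unfolding hermite_integrand_def gauss_kernel_def case_prod_beta
    by (intro continuous_intros xs) (auto simp: simplex2_def)
qed

lemma abs_le_max_abs:
  assumes x: "continuous_on {0..1} x" and s: "s \<in> {0..1}"
  shows "\<bar>x s $ i\<bar> \<le> max_abs x i"
  unfolding max_abs_def
proof (rule cSUP_upper[OF s])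
  have "compact ((\<lambda>s. \<bar>x s $ i\<bar>) ` {0..1})"
    by (intro compact_continuous_image continuous_intros x) auto
  then show "bdd_above ((\<lambda>s. \<bar>x s $ i\<bar>) ` {0..1})"
    by (intro bounded_imp_bdd_above compact_imp_bounded)
qed

text \<open>
  Both end points of an increment are bounded by \<open>max_abs x j\<close>, which is where the factor \<open>2\<close> in
  the exponent comes from.
\<close>

lemma increment_product_le:
  fixes x :: "real \<Rightarrow> real ^ 'd::finite"
  assumes x: "continuous_on {0..1} x" and s: "s \<in> {0..1}" and t: "t \<in> {0..1}"
  shows "(\<Prod>j\<in>UNIV. (1 + \<bar>x t $ j - x s $ j\<bar>) ^ n j)
           \<le> (\<Prod>j\<in>UNIV. fact (n j) * exp 1) * exp (\<Sum>j\<in>UNIV. 2 * max_abs x j)"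
proof -
  have "(1 + \<bar>x t $ j - x s $ j\<bar>) ^ n j \<le> (fact (n j) * exp 1) * exp (2 * max_abs x j)" for j
  proof -
    have "(1 + \<bar>x t $ j - x s $ j\<bar>) ^ n j \<le> fact (n j) * exp (1 + \<bar>x t $ j - x s $ j\<bar>)"
      by (rule power_le_fact_exp) simp
    also have "\<dots> \<le> fact (n j) * exp (1 + 2 * max_abs x j)"
      using abs_le_max_abs[OF x s, of j] abs_le_max_abs[OF x t, of j] by simp
    finally show ?thesis by (simp add: exp_add)
  qed
  then have "(\<Prod>j\<in>UNIV. (1 + \<bar>x t $ j - x s $ j\<bar>) ^ n j)
      \<le> (\<Prod>j\<in>UNIV. (fact (n j) * exp 1) * exp (2 * max_abs x j))"
    by (intro prod_mono) auto
  then show ?thesis by (simp only: prod.distrib exp_sum finite)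
qed

theorem theorem2:
  assumes "CARD('d::finite) \<ge> 2"
  shows "\<exists>(C0 :: real) (C :: ('d \<Rightarrow> nat) \<Rightarrow> real).
    \<forall>(M :: 'a measure) (w :: real \<Rightarrow> 'a \<Rightarrow> real ^ 'd) (n :: 'd \<Rightarrow> nat).
      brownian_motion M w \<longrightarrow>
      (AE \<omega> in M. \<forall>\<^sub>F u in at (0 :: real ^ 'd).
         set_integrable lborel simplex2 (hermite_integrand n (\<lambda>t. w t \<omega>) u) \<and>
         \<bar>set_lebesgue_integral lborel simplex2 (hermite_integrand n (\<lambda>t. w t \<omega>) u)\<bar>
           \<le> (if CARD('d) = 2 \<and> (\<forall>j. n j = 0)
               then C0 * ln (1 / norm u)
               else C n * (exp (\<Sum>i\<in>UNIV. 2 * max_abs (\<lambda>t. w t \<omega>) i)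
                             / norm u ^ ((\<Sum>j\<in>UNIV. n j) + CARD('d) - 2))))"
proof -
  obtain K where K0: "\<And>n. K n \<ge> 0"
    and K: "\<And>n x (u :: real ^ 'd) s t. 0 < t - s \<Longrightarrow> t - s \<le> 1 \<Longrightarrow>
     \<bar>hermite_integrand n x u (s, t)\<bar>
       \<le> K n * (\<Prod>j\<in>UNIV. (1 + \<bar>x t $ j - x s $ j\<bar>) ^ n j)
           * (t - s + (norm u)\<^sup>2) powr (- real ((\<Sum>j\<in>UNIV. n j) + CARD('d)) / 2)"
    using hermite_integrand_pointwise_bound[where 'd = 'd] by blast
  define C where "C n = K n * (\<Prod>j\<in>UNIV. fact (n j) * exp 1) * 2" for n :: "'d \<Rightarrow> nat"
  define C0 where "C0 = K (\<lambda>_. 0) * 3"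
  have path: "\<forall>\<^sub>F u in at 0.
      set_integrable lborel simplex2 (hermite_integrand n x u) \<and>
      \<bar>set_lebesgue_integral lborel simplex2 (hermite_integrand n x u)\<bar>
        \<le> (if CARD('d) = 2 \<and> (\<forall>j. n j = 0)
            then C0 * ln (1 / norm u)
            else C n * (exp (\<Sum>i\<in>UNIV. 2 * max_abs x i)
                          / norm u ^ ((\<Sum>j\<in>UNIV. n j) + CARD('d) - 2)))"
    if x: "continuous_on {0..1} x" for x :: "real \<Rightarrow> real ^ 'd" and n
  proof (cases "CARD('d) = 2 \<and> (\<forall>j. n j = 0)")
    case True
    then have n: "n = (\<lambda>_. 0)" by auto
    have "set_integrable lborel simplex2 (hermite_integrand n x u) \<and>
        \<bar>set_lebesgue_integral lborel simplex2 (hermite_integrand n x u)\<bar> \<le> K n * (3 * ln (1 / norm u))"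
      if "u \<noteq> 0" "norm u \<le> 1 / 2" for u
    proof (rule simplex2_integral_log_bound[OF continuous_on_hermite_integrand[OF x] _ K0])
      fix s t assume "(s, t) \<in> simplex2"
      then show "\<bar>hermite_integrand n x u (s, t)\<bar> \<le> K n * (t - s + (norm u)\<^sup>2) powr (- 1)"
        using K[of t s n x u] True by (simp add: simplex2_def n)
    qed (use that in auto)
    moreover have "\<forall>\<^sub>F u in at (0 :: real ^ 'd). u \<noteq> 0 \<and> norm u \<le> 1 / 2"
      unfolding eventually_at by (intro exI[of _ "1 / 2"]) auto
    ultimately show ?thesis
      using True by (auto elim!: eventually_mono simp: C0_def n mult_ac)
  next
    case False
    define k where "k = (\<Sum>j\<in>UNIV. n j) + CARD('d)"
    define E where "E = (\<Prod>j\<in>UNIV. fact (n j) * exp 1) * exp (\<Sum>i\<in>UNIV. 2 * max_abs x i)"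
    have E0: "0 \<le> E" by (auto simp: E_def intro!: mult_nonneg_nonneg prod_nonneg)
    have k: "3 \<le> k"
    proof (cases "CARD('d) = 2")
      case True
      with False have "(\<Sum>j\<in>UNIV. n j) \<noteq> 0" by auto
      then have "1 \<le> (\<Sum>j\<in>UNIV. n j)" by linarith
      with True show ?thesis unfolding k_def by linarith
    qed (use assms in \<open>simp add: k_def\<close>)
    have "set_integrable lborel simplex2 (hermite_integrand n x u) \<and>
        \<bar>set_lebesgue_integral lborel simplex2 (hermite_integrand n x u)\<bar>
          \<le> K n * E * (2 / norm u ^ (k - 2))"
      if "u \<noteq> 0" for u
    proof (rule simplex2_integral_power_bound[OF continuous_on_hermite_integrand[OF x] _ _ _ k])
      fix s t assume st: "(s, t) \<in> simplex2"
      then have "\<bar>hermite_integrand n x u (s, t)\<bar>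
         \<le> K n * (\<Prod>j\<in>UNIV. (1 + \<bar>x t $ j - x s $ j\<bar>) ^ n j)
             * (t - s + (norm u)\<^sup>2) powr (- real k / 2)"
        unfolding k_def by (intro K) (auto simp: simplex2_def)
      also have "\<dots> \<le> K n * E * (t - s + (norm u)\<^sup>2) powr (- real k / 2)"
        using st K0 unfolding E_def
        by (intro mult_right_mono mult_left_mono increment_product_le[OF x]) (auto simp: simplex2_def)
      finally show "\<bar>hermite_integrand n x u (s, t)\<bar>
          \<le> K n * E * (t - s + (norm u)\<^sup>2) powr (- real k / 2)" .
    qed (use that K0 E0 in auto)
    moreover have "\<forall>\<^sub>F u in at (0 :: real ^ 'd). u \<noteq> 0" by (rule eventually_neq_at_within)
    ultimately show ?thesis
      using False unfolding k_def E_def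
      by (auto elim!: eventually_mono simp: C_def mult_ac)
  qed
  show ?thesis
  proof (intro exI[of _ C0] exI[of _ C] allI impI)
    fix M :: "'a measure" and w :: "real \<Rightarrow> 'a \<Rightarrow> real ^ 'd" and n :: "'d \<Rightarrow> nat"
    assume "brownian_motion M w"
    then have "AE \<omega> in M. continuous_on {0..1} (\<lambda>t. w t \<omega>)"
      by (rule brownian_motion.continuous_paths)
    then show "AE \<omega> in M. \<forall>\<^sub>F u in at (0 :: real ^ 'd).
         set_integrable lborel simplex2 (hermite_integrand n (\<lambda>t. w t \<omega>) u) \<and>
         \<bar>set_lebesgue_integral lborel simplex2 (hermite_integrand n (\<lambda>t. w t \<omega>) u)\<bar>
           \<le> (if CARD('d) = 2 \<and> (\<forall>j. n j = 0)
               then C0 * ln (1 / norm u)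
               else C n * (exp (\<Sum>i\<in>UNIV. 2 * max_abs (\<lambda>t. w t \<omega>) i)
                             / norm u ^ ((\<Sum>j\<in>UNIV. n j) + CARD('d) - 2)))"
      by eventually_elim (rule path)
  qed
qed

end
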